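(* Let $\alpha>0$ and let $(z,u,p)$ be the exact solution triple of the optimality system $$-\Delta z-u=f \text{ in }\Omega,\quad z=0\text{ on }\partial\Omega;\qquad -\Delta p+z=g\text{ in }\Omega,\quad p=0\text{ on }\partial\Omega;\qquad \alpha u-p=0\text{ in }\Omega,$$ where $\Omega=(0,1)^2$. Suppose $\{z,u,p\}\subset C^4(\overline\Omega)$. Let $\gamma=1$. Then the regularized finite difference scheme $$-\Delta_h z_h-u_h=f_h,\qquad -\Delta_h p_h+(I_h-\gamma\Delta_h)z_h=(I_h-\gamma\Delta_h)g_h,\qquad \alpha(I_h-\gamma\Delta_h)u_h-p_h=0$$ has second-order accuracy in $u_h$ and $z_h$ with respect to the infinity norm: there is a constant $C>0$, independent of $h$, such that for every $h=1/N$ (integer $N\ge 2$) the solution $(z_h,u_h,p_h)$ of the scheme satisfies $$\|z-z_h\|_\infty\le Ch^2,\qquad \|u-u_h\|_\infty\le Ch^2,$$ where $z,u$ are evaluated at the interior grid points.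
   Context: The system is the first-order optimality (KKT) system of minimizing $\frac12\int_\Omega (z-g)^2dx+\frac{\alpha}{2}\int_\Omega u^2dx$ over $u\in L^2(\Omega)$ subject to $-\Delta z=u+f$ in $\Omega$, $z=0$ on $\partial\Omega$, with $f,g\in L^2(\Omega)$; $p$ is the adjoint state. Under the stated regularity, $f$ and $g$ are identified with their continuous representatives on $\overline\Omega$. Grid: $h=1/N$, grid points $(x_i,y_j)=(ih,jh)$, $0\le i,j\le N$; $\Omega_h$ is the set of interior grid points ($1\le i,j\le N-1$). $z_h,u_h,p_h$ are grid functions on $\Omega_h$ (vectors), and $f_h,g_h$ are the restrictions of $f,g$ to $\Omega_h$. $I_h$ is the identity matrix and $\Delta_h$ is the 5-point discrete Laplacian matrix with homogeneous Dirichlet boundary conditions: $(\Delta_h v)_{ij}=h^{-2}(v_{i+1,j}+v_{i-1,j}+v_{i,j+1}+v_{i,j-1}-4v_{ij})$ for $1\le i,j\le N-1$, where $v$ is set to $0$ at boundary nodes (this matrix is also the one applied to $g_h$). $\|v\|_\infty=\max_{1\le i,j\le N-1}|v_{ij}|$. *)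

theory Defs
  imports "HOL-Analysis.Analysis"
begin

definition partial :: "'a::euclidean_space \<Rightarrow> ('a \<Rightarrow> real) \<Rightarrow> 'a \<Rightarrow> real" where
  "partial b v x = deriv (\<lambda>t. v (x + t *\<^sub>R b)) 0"

definition laplacian :: "('a::euclidean_space \<Rightarrow> real) \<Rightarrow> 'a \<Rightarrow> real" where
  "laplacian v x = (\<Sum>b\<in>Basis. partial b (partial b v) x)"

text \<open>
  For open \<open>S\<close>: all iterated partial derivatives of \<open>v\<close> of order at most \<open>k\<close> exist in \<open>S\<close>
  and extend continuously to the closure of \<open>S\<close>. The derivatives are constrained on \<open>S\<close> only;
  the existence of an extension already makes them continuous on \<open>S\<close>.
\<close>

primrec derivs_extend :: "nat \<Rightarrow> 'a::euclidean_space set \<Rightarrow> ('a \<Rightarrow> real) \<Rightarrow> bool" where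
  "derivs_extend 0 S v \<longleftrightarrow>
     (\<exists>w. continuous_on (closure S) w \<and> (\<forall>x\<in>S. w x = v x))"
| "derivs_extend (Suc k) S v \<longleftrightarrow>
     (\<exists>w. continuous_on (closure S) w \<and> (\<forall>x\<in>S. w x = v x)) \<and>
     (\<forall>b\<in>Basis. (\<forall>x\<in>S. (\<lambda>t. v (x + t *\<^sub>R b)) differentiable at 0) \<and>
        derivs_extend k S (partial b v))"

text \<open>
  The space of \<open>C\<^sup>k\<close> functions up to the boundary of an open set \<open>S\<close>. Requiring continuity of \<open>v\<close>
  itself on the closure makes its boundary values those of its continuous extension.
\<close>

definition C_closure :: "nat \<Rightarrow> 'a::euclidean_space set \<Rightarrow> ('a \<Rightarrow> real) set" where
  "C_closure k S = {v. continuous_on (closure S) v \<and> derivs_extend k S v}"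

definition \<Omega> :: "(real \<times> real) set" where
  "\<Omega> = {0<..<1} \<times> {0<..<1}"

text \<open>
  The data \<open>f\<close>, \<open>g\<close> are the continuous representatives on the closed square, so the
  equations hold pointwise.
\<close>

definition optimality_system ::
  "real \<Rightarrow> (real \<times> real \<Rightarrow> real) \<Rightarrow> (real \<times> real \<Rightarrow> real) \<Rightarrow>
   (real \<times> real \<Rightarrow> real) \<Rightarrow> (real \<times> real \<Rightarrow> real) \<Rightarrow> (real \<times> real \<Rightarrow> real) \<Rightarrow> bool" where
  "optimality_system \<alpha> f g z u p \<longleftrightarrow>
     (\<forall>x\<in>\<Omega>. - laplacian z x - u x = f x) \<and> (\<forall>x\<in>frontier \<Omega>. z x = 0) \<and>
     (\<forall>x\<in>\<Omega>. - laplacian p x + z x = g x) \<and> (\<forall>x\<in>frontier \<Omega>. p x = 0) \<and>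
     (\<forall>x\<in>\<Omega>. \<alpha> * u x - p x = 0)"

definition inner_nodes :: "nat \<Rightarrow> (nat \<times> nat) set" where
  "inner_nodes N = {1..N - 1} \<times> {1..N - 1}"

text \<open>
  A vector on the interior nodes is encoded as a function of the index pair that vanishes at
  all other indices, in particular at the boundary nodes.
\<close>

definition grid_functions :: "nat \<Rightarrow> (nat \<times> nat \<Rightarrow> real) set" where
  "grid_functions N = {v. \<forall>k. k \<notin> inner_nodes N \<longrightarrow> v k = 0}"

definition restrict_grid :: "nat \<Rightarrow> (real \<times> real \<Rightarrow> real) \<Rightarrow> nat \<times> nat \<Rightarrow> real" where
  "restrict_grid N w = (\<lambda>(i, j).
     if (i, j) \<in> inner_nodes N then w (real i / real N, real j / real N) else 0)"

definition discrete_laplacian :: "nat \<Rightarrow> (nat \<times> nat \<Rightarrow> real) \<Rightarrow> nat \<times> nat \<Rightarrow> real" where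
  "discrete_laplacian N v = (\<lambda>(i, j).
     if (i, j) \<in> inner_nodes N
     then (v (i + 1, j) + v (i - 1, j) + v (i, j + 1) + v (i, j - 1) - 4 * v (i, j)) / (1 / real N)\<^sup>2
     else 0)"

definition grid_norm :: "nat \<Rightarrow> (nat \<times> nat \<Rightarrow> real) \<Rightarrow> real" where
  "grid_norm N v = Max ((\<lambda>k. \<bar>v k\<bar>) ` inner_nodes N)"

definition regularized_scheme ::
  "real \<Rightarrow> real \<Rightarrow> (real \<times> real \<Rightarrow> real) \<Rightarrow> (real \<times> real \<Rightarrow> real) \<Rightarrow> nat \<Rightarrow>
   (nat \<times> nat \<Rightarrow> real) \<Rightarrow> (nat \<times> nat \<Rightarrow> real) \<Rightarrow> (nat \<times> nat \<Rightarrow> real) \<Rightarrow> bool" where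
  "regularized_scheme \<alpha> \<gamma> f g N z\<^sub>h u\<^sub>h p\<^sub>h \<longleftrightarrow>
     z\<^sub>h \<in> grid_functions N \<and> u\<^sub>h \<in> grid_functions N \<and> p\<^sub>h \<in> grid_functions N \<and>
     (let f\<^sub>h = restrict_grid N f; g\<^sub>h = restrict_grid N g; \<Delta>\<^sub>h = discrete_laplacian N in
      \<forall>k\<in>inner_nodes N.
        - \<Delta>\<^sub>h z\<^sub>h k - u\<^sub>h k = f\<^sub>h k \<and>
        - \<Delta>\<^sub>h p\<^sub>h k + (z\<^sub>h k - \<gamma> * \<Delta>\<^sub>h z\<^sub>h k) = g\<^sub>h k - \<gamma> * \<Delta>\<^sub>h g\<^sub>h k \<and>
        \<alpha> * (u\<^sub>h k - \<gamma> * \<Delta>\<^sub>h u\<^sub>h k) - p\<^sub>h k = 0)"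

end

theory Submission
  imports Defs "HOL-Library.Function_Algebras"
begin

text \<open>
  Write \<open>A\<close> for minus the discrete Laplacian and \<open>I\<close> for the identity. The operator \<open>I + A\<close>
  commutes with \<open>A\<close> and is injective. Substituting \<open>p\<^sub>h = \<alpha> (I + A) u\<^sub>h\<close> into the adjoint equation
  turns it into \<open>(I + A) (\<alpha> A u\<^sub>h + z\<^sub>h - g\<^sub>h) = 0\<close>, so the regularized scheme is equivalent to the
  pair \<open>A z\<^sub>h - u\<^sub>h = f\<^sub>h\<close>, \<open>\<alpha> A u\<^sub>h + z\<^sub>h = g\<^sub>h\<close> (\<open>regularized_scheme_iff\<close>). In particular the
  zero extension of \<open>g\<^sub>h\<close>, to which the discrete Laplacian is applied in the scheme and which may
  jump at the boundary, causes no error.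

  Stability of this pair comes from an identity. If \<open>A v - w = r\<close> and \<open>\<alpha> A w + v = s\<close>, then in
  \<open>\<alpha> |r|\<^sup>2 + |s|\<^sup>2\<close>, with the Euclidean norm of grid vectors, the two mixed terms cancel because \<open>A\<close>
  is symmetric, which leaves \<open>\<alpha> |A v|\<^sup>2 + \<alpha> |w|\<^sup>2 + \<alpha>\<^sup>2 |A w|\<^sup>2 + |v|\<^sup>2\<close>
  (\<open>stability_identity\<close>). This gives uniqueness; existence follows because
  the system is square. To pass from Euclidean norms to the maximum norm, a discrete Sobolev
  inequality bounds a grid function that vanishes on the boundary by its discrete Laplacian
  (\<open>discrete_sobolev\<close>): the value at a node is a sum of mixed second differences, and summation by
  parts shows that twice their square sum is at most that of \<open>h\<^sup>2 A v\<close>.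

  The error of the scheme satisfies the same pair of equations with the truncation errors of \<open>z\<close>
  and of \<open>p = \<alpha> u\<close> on the right-hand side. By Taylor's formula these are of order \<open>h\<^sup>2\<close>
  (\<open>discrete_laplacian_truncation\<close>).
\<close>

section \<open>Square linear systems\<close>

text \<open>
  A linear operator on the functions supported in \<open>S\<close> acts on a space of dimension \<open>card S\<close>. If it
  is injective, it maps the unit vectors to \<open>card S\<close> independent vectors, and no further vector is
  independent of these.
\<close>



lemma injective_imp_surjective_finite_support:
  fixes L :: "('a \<Rightarrow> real) \<Rightarrow> 'a \<Rightarrow> real"
  assumes "finite S"
    and add: "\<And>v w. L (\<lambda>k. v k + w k) = (\<lambda>k. L v k + L w k)"
    and scale: "\<And>c v. L (\<lambda>k. c * v k) = (\<lambda>k. c * L v k)"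
    and maps: "\<And>v. \<forall>k. k \<notin> S \<longrightarrow> v k = 0 \<Longrightarrow> \<forall>k. k \<notin> S \<longrightarrow> L v k = 0"
    and inj: "\<And>v. \<forall>k. k \<notin> S \<longrightarrow> v k = 0 \<Longrightarrow> \<forall>k. L v k = 0 \<Longrightarrow> \<forall>k. v k = 0"
    and b: "\<forall>k. k \<notin> S \<longrightarrow> b k = 0"
  shows "\<exists>v. (\<forall>k. k \<notin> S \<longrightarrow> v k = 0) \<and> L v = b"
proof -
  define sc where "sc = (\<lambda>c (v :: 'a \<Rightarrow> real) k. c * v k)"
  define \<delta> where "\<delta> = (\<lambda>(i :: 'a) k. if k = i then 1 else 0 :: real)"
  have vs: "vector_space sc"
    by unfold_locales (auto simp: sc_def fun_eq_iff algebra_simps)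
  interpret vector_space sc by (rule vs)
  interpret L: Vector_Spaces.linear sc sc L
    unfolding Vector_Spaces.linear_def module_hom_def module_hom_axioms_def
    using vs add scale by (auto simp: sc_def plus_fun_def module_iff_vector_space)
  have expand: "sum (\<lambda>i. sc (v i) (\<delta> i)) S = v" if "\<forall>k. k \<notin> S \<longrightarrow> v k = 0" for v
  proof
    fix k
    have "sum (\<lambda>i. sc (v i) (\<delta> i)) S k = (\<Sum>i\<in>S. v i * \<delta> i k)"
      by (induct S rule: infinite_finite_induct) (auto simp: sc_def)
    also have "\<dots> = v k"
      using \<open>finite S\<close> that by (auto simp: \<delta>_def if_distrib cong: if_cong)
    finally show "sum (\<lambda>i. sc (v i) (\<delta> i)) S k = v k" .
  qed
  have in_span: "v \<in> span (\<delta> ` S)" if "\<forall>k. k \<notin> S \<longrightarrow> v k = 0" for v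
    by (subst expand[OF that, symmetric]) (intro span_sum span_scale span_base imageI)
  have sub: "subspace {v. \<forall>k. k \<notin> S \<longrightarrow> v k = 0}"
    unfolding subspace_def by (simp add: sc_def)
  have span_supp: "span (\<delta> ` S) \<subseteq> {v. \<forall>k. k \<notin> S \<longrightarrow> v k = 0}"
    by (rule span_minimal[OF _ sub]) (auto simp: \<delta>_def)
  have inj_span: "inj_on L (span (\<delta> ` S))"
  proof (subst L.inj_on_iff_eq_0)
    show "\<forall>v\<in>span (\<delta> ` S). L v = 0 \<longrightarrow> v = 0"
    proof (intro ballI impI ext)
      fix v k assume "v \<in> span (\<delta> ` S)" "L v = 0"
      then have "\<forall>k. k \<notin> S \<longrightarrow> v k = 0" "\<forall>k. L v k = 0" using span_supp by auto
      then show "v k = 0 k" using inj by simp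
    qed
  qed (rule subspace_span)
  have inj_\<delta>: "inj_on \<delta> S"
  proof (rule inj_onI)
    fix i j assume "\<delta> i = \<delta> j"
    then have "\<delta> i i = \<delta> j i" by simp
    then show "i = j" by (simp add: \<delta>_def split: if_splits)
  qed
  have indep: "independent (\<delta> ` S)"
  proof (rule independent_if_scalars_zero)
    fix c v assume *: "(\<Sum>v\<in>\<delta> ` S. sc (c v) v) = 0" and "v \<in> \<delta> ` S"
    then obtain i where i: "i \<in> S" "v = \<delta> i" by auto
    have "0 = (\<Sum>v\<in>\<delta> ` S. sc (c v) v) i" using * by simp
    also have "\<dots> = (\<Sum>j\<in>S. sc (c (\<delta> j)) (\<delta> j)) i"
      by (simp add: sum.reindex[OF inj_\<delta>])
    also have "\<dots> = (\<Sum>j\<in>S. sc (if j \<in> S then c (\<delta> j) else 0) (\<delta> j)) i"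
      by (simp cong: sum.cong)
    also have "\<dots> = c v"
      by (subst expand) (use i in auto)
    finally show "c v = 0" by simp
  qed (use \<open>finite S\<close> in auto)
  have indepL: "independent (L ` \<delta> ` S)"
    by (rule L.independent_injective_image[OF indep inj_span])
  have cardL: "card (L ` \<delta> ` S) = card S"
    using card_image[OF inj_on_subset[OF inj_span span_superset]] card_image[OF inj_\<delta>] by simp
  have "b \<in> span (L ` \<delta> ` S)"
  proof (rule ccontr)
    assume nb: "b \<notin> span (L ` \<delta> ` S)"
    have "independent (insert b (L ` \<delta> ` S))"
      using nb indepL by (simp add: independent_insert)
    moreover have "L v \<in> span (\<delta> ` S)" if "v \<in> \<delta> ` S" for v
    proof (intro in_span maps)
      show "\<forall>k. k \<notin> S \<longrightarrow> v k = 0" using span_supp span_base[OF that] by auto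
    qed
    then have "insert b (L ` \<delta> ` S) \<subseteq> span (\<delta> ` S)"
      using in_span[OF b] by auto
    ultimately have "card (insert b (L ` \<delta> ` S)) \<le> card (\<delta> ` S)"
      using independent_span_bound[of "\<delta> ` S"] \<open>finite S\<close> by simp
    moreover have "b \<notin> L ` \<delta> ` S" using nb span_base by metis
    ultimately show False
      using \<open>finite S\<close> cardL by (simp add: card_image[OF inj_\<delta>])
  qed
  then show ?thesis
    using span_supp by (auto simp: L.span_image)
qed

section \<open>Summation by parts for the five-point Laplacian\<close>

lemma inner_nodes_iff: "(i, j) \<in> inner_nodes N \<longleftrightarrow> 1 \<le> i \<and> i < N \<and> 1 \<le> j \<and> j < N"
  by (auto simp: inner_nodes_def)

lemma finite_inner_nodes [simp]: "finite (inner_nodes N)"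
  by (simp add: inner_nodes_def)

lemma discrete_laplacian_linear:
  "discrete_laplacian N (\<lambda>k. a * v k + b * w k) k
     = a * discrete_laplacian N v k + b * discrete_laplacian N w k"
  by (cases k) (simp add: discrete_laplacian_def field_simps)

lemma discrete_laplacian_outside: "k \<notin> inner_nodes N \<Longrightarrow> discrete_laplacian N v k = 0"
  by (cases k) (simp add: discrete_laplacian_def)

lemma discrete_laplacian_in_grid_functions: "discrete_laplacian N v \<in> grid_functions N"
  by (simp add: grid_functions_def discrete_laplacian_outside)

lemma summation_by_parts:
  fixes a b :: "nat \<Rightarrow> real"
  assumes "b 0 = 0" "b N = 0"
  shows "(\<Sum>i\<in>{1..N - 1}. (a (i + 1) + a (i - 1) - 2 * a i) * b i)
    = - (\<Sum>i<N. (a (Suc i) - a i) * (b (Suc i) - b i))"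
proof (cases N)
  case (Suc n)
  \<comment> \<open>Without boundary conditions two boundary terms appear, which makes the identity inductive.\<close>
  have "(\<Sum>i\<in>{1..m}. (a (i + 1) + a (i - 1) - 2 * a i) * b i)
    = - (\<Sum>i<Suc m. (a (Suc i) - a i) * (b (Suc i) - b i)) + (a (Suc m) - a m) * b (Suc m)
      - (a 1 - a 0) * b 0" for m
    by (induct m) (auto simp: algebra_simps)
  from this[of n] show ?thesis using assms Suc by simp
qed simp

text \<open>
  These differences are not divided by the mesh width; \<open>discrete_laplacian_inner\<close> supplies the factor
  \<open>N\<^sup>2\<close>. On inner nodes the subtraction in \<open>i - 1\<close> and \<open>j - 1\<close> is not truncated.
\<close>

definition dxx :: "(nat \<times> nat \<Rightarrow> real) \<Rightarrow> nat \<Rightarrow> nat \<Rightarrow> real" where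
  "dxx v i j = v (i + 1, j) + v (i - 1, j) - 2 * v (i, j)"

definition dyy :: "(nat \<times> nat \<Rightarrow> real) \<Rightarrow> nat \<Rightarrow> nat \<Rightarrow> real" where
  "dyy v i j = v (i, j + 1) + v (i, j - 1) - 2 * v (i, j)"

lemma discrete_laplacian_inner:
  "(i, j) \<in> inner_nodes N \<Longrightarrow> discrete_laplacian N v (i, j) = (real N)\<^sup>2 * (dxx v i j + dyy v i j)"
  by (simp add: discrete_laplacian_def dxx_def dyy_def power_divide field_simps)

lemma sum_inner_nodes:
  "sum f (inner_nodes N) = (\<Sum>i\<in>{1..N-1}. \<Sum>j\<in>{1..N-1}. f (i, j))"
  by (simp add: inner_nodes_def sum.cartesian_product)

lemma grid_functions_zero: "v \<in> grid_functions N \<Longrightarrow> k \<notin> inner_nodes N \<Longrightarrow> v k = 0"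
  unfolding grid_functions_def by blast

lemma grid_functions_boundary:
  assumes "v \<in> grid_functions N"
  shows "v (0, j) = 0" "v (N, j) = 0" "v (i, 0) = 0" "v (i, N) = 0"
  using assms by (auto simp: grid_functions_def inner_nodes_iff)

text \<open>
  The discrete Green formula. Its right-hand side is symmetric in \<open>v\<close> and \<open>w\<close> and nonpositive for
  \<open>v = w\<close>.
\<close>

lemma discrete_green:
  assumes w: "w \<in> grid_functions N"
  shows "(\<Sum>k\<in>inner_nodes N. discrete_laplacian N v k * w k) =
    - (real N)\<^sup>2 * ((\<Sum>j\<in>{1..N-1}. \<Sum>i<N. (v (Suc i, j) - v (i, j)) * (w (Suc i, j) - w (i, j)))
      + (\<Sum>i\<in>{1..N-1}. \<Sum>j<N. (v (i, Suc j) - v (i, j)) * (w (i, Suc j) - w (i, j))))"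
    (is "_ = - _ * (?X + ?Y)")
proof -
  have "(\<Sum>k\<in>inner_nodes N. discrete_laplacian N v k * w k)
    = (\<Sum>k\<in>inner_nodes N. (real N)\<^sup>2 * (dxx v (fst k) (snd k) * w k + dyy v (fst k) (snd k) * w k))"
    by (intro sum.cong) (auto simp: discrete_laplacian_inner algebra_simps)
  also have "\<dots> = (real N)\<^sup>2 * ((\<Sum>j\<in>{1..N-1}. \<Sum>i\<in>{1..N-1}. dxx v i j * w (i, j))
      + (\<Sum>i\<in>{1..N-1}. \<Sum>j\<in>{1..N-1}. dyy v i j * w (i, j)))"
    by (subst sum.swap) (simp add: sum_inner_nodes sum.distrib flip: sum_distrib_left)
  also have "(\<Sum>j\<in>{1..N-1}. \<Sum>i\<in>{1..N-1}. dxx v i j * w (i, j)) = - ?X"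
    unfolding dxx_def by (subst sum_negf[symmetric], intro sum.cong refl
        summation_by_parts[of "\<lambda>i. w (i, _)" N "\<lambda>i. v (i, _)"] grid_functions_boundary[OF w])
  also have "(\<Sum>i\<in>{1..N-1}. \<Sum>j\<in>{1..N-1}. dyy v i j * w (i, j)) = - ?Y"
    unfolding dyy_def by (subst sum_negf[symmetric], intro sum.cong refl
        summation_by_parts[of "\<lambda>j. w (_, j)" N "\<lambda>j. v (_, j)"] grid_functions_boundary[OF w])
  finally show ?thesis by (simp add: algebra_simps)
qed

lemma discrete_laplacian_symmetric:
  assumes "v \<in> grid_functions N" "w \<in> grid_functions N"
  shows "(\<Sum>k\<in>inner_nodes N. discrete_laplacian N v k * w k)
    = (\<Sum>k\<in>inner_nodes N. v k * discrete_laplacian N w k)"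
  using discrete_green[OF assms(1), of w] discrete_green[OF assms(2), of v]
  by (simp add: mult.commute)

lemma discrete_laplacian_nonpos:
  assumes "v \<in> grid_functions N"
  shows "(\<Sum>k\<in>inner_nodes N. discrete_laplacian N v k * v k) \<le> 0"
  unfolding discrete_green[OF assms] by (simp add: sum_nonneg add_nonneg_nonneg)

section \<open>A discrete Sobolev inequality\<close>

definition dxy :: "(nat \<times> nat \<Rightarrow> real) \<Rightarrow> nat \<Rightarrow> nat \<Rightarrow> real" where
  "dxy v i j = v (Suc i, Suc j) - v (i, Suc j) - v (Suc i, j) + v (i, j)"

text \<open>
  The discrete form of \<open>\<integral> v\<^sub>x\<^sub>x v\<^sub>y\<^sub>y = \<integral> v\<^sub>x\<^sub>y\<^sup>2\<close>: summation by parts is applied once in each direction.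
  No boundary terms arise, since \<open>dyy v\<close> vanishes on the sides \<open>i = 0\<close> and \<open>i = N\<close>, and the first
  difference of \<open>v\<close> in direction \<open>i\<close> vanishes on the sides \<open>j = 0\<close> and \<open>j = N\<close>.
\<close>

lemma sum_dxx_dyy:
  assumes v: "v \<in> grid_functions N"
  shows "(\<Sum>i\<in>{1..N-1}. \<Sum>j\<in>{1..N-1}. dxx v i j * dyy v i j) = (\<Sum>i<N. \<Sum>j<N. (dxy v i j)\<^sup>2)"
proof -
  note bd = grid_functions_boundary[OF v]
  have "(\<Sum>i\<in>{1..N-1}. \<Sum>j\<in>{1..N-1}. dxx v i j * dyy v i j)
    = (\<Sum>j\<in>{1..N-1}. \<Sum>i\<in>{1..N-1}. dxx v i j * dyy v i j)"
    by (rule sum.swap)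
  also have "\<dots> = (\<Sum>j\<in>{1..N-1}. - (\<Sum>i<N. (v (Suc i, j) - v (i, j)) * (dyy v (Suc i) j - dyy v i j)))"
    unfolding dxx_def
    by (intro sum.cong refl summation_by_parts[of "\<lambda>i. dyy v i _" N "\<lambda>i. v (i, _)"])
      (simp_all add: dyy_def bd)
  also have "\<dots> = (\<Sum>i<N. - (\<Sum>j\<in>{1..N-1}. (dyy v (Suc i) j - dyy v i j) * (v (Suc i, j) - v (i, j))))"
    unfolding sum_negf by (subst sum.swap) (simp add: mult.commute)
  also have "\<dots> = (\<Sum>i<N. \<Sum>j<N. (dxy v i j)\<^sup>2)"
  proof (intro sum.cong refl)
    fix i
    have "(\<Sum>j\<in>{1..N-1}. (dyy v (Suc i) j - dyy v i j) * (v (Suc i, j) - v (i, j)))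
      = (\<Sum>j\<in>{1..N-1}. ((v (Suc i, j + 1) - v (i, j + 1)) + (v (Suc i, j - 1) - v (i, j - 1))
           - 2 * (v (Suc i, j) - v (i, j))) * (v (Suc i, j) - v (i, j)))"
      by (intro sum.cong refl) (simp add: dyy_def algebra_simps)
    also have "\<dots> = - (\<Sum>j<N. ((v (Suc i, Suc j) - v (i, Suc j)) - (v (Suc i, j) - v (i, j)))
        * ((v (Suc i, Suc j) - v (i, Suc j)) - (v (Suc i, j) - v (i, j))))"
      by (rule summation_by_parts[of "\<lambda>j. v (Suc i, j) - v (i, j)" N "\<lambda>j. v (Suc i, j) - v (i, j)"])
        (simp_all add: bd)
    also have "\<dots> = - (\<Sum>j<N. (dxy v i j)\<^sup>2)"
      by (simp add: dxy_def power2_eq_square algebra_simps)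
    finally show "- (\<Sum>j\<in>{1..N-1}. (dyy v (Suc i) j - dyy v i j) * (v (Suc i, j) - v (i, j)))
      = (\<Sum>j<N. (dxy v i j)\<^sup>2)" by simp
  qed
  finally show ?thesis .
qed

text \<open>
  In the square of \<open>dxx v + dyy v\<close> only the mixed term is kept; the factor \<open>N\<^sup>4\<close> is \<open>h\<close> to the
  power \<open>-4\<close>.
\<close>

lemma sum_dxy_le_discrete_laplacian:
  assumes v: "v \<in> grid_functions N"
  shows "2 * real N ^ 4 * (\<Sum>i<N. \<Sum>j<N. (dxy v i j)\<^sup>2)
    \<le> (\<Sum>k\<in>inner_nodes N. (discrete_laplacian N v k)\<^sup>2)"
proof -
  have "2 * real N ^ 4 * (\<Sum>i<N. \<Sum>j<N. (dxy v i j)\<^sup>2)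
    = (\<Sum>i\<in>{1..N-1}. \<Sum>j\<in>{1..N-1}. 2 * real N ^ 4 * (dxx v i j * dyy v i j))"
    by (simp add: sum_dxx_dyy[OF v, symmetric] flip: sum_distrib_left)
  also have "\<dots> \<le> (\<Sum>i\<in>{1..N-1}. \<Sum>j\<in>{1..N-1}. (discrete_laplacian N v (i, j))\<^sup>2)"
  proof (intro sum_mono)
    fix i j assume "i \<in> {1..N-1}" "j \<in> {1..N-1}"
    then have "(i, j) \<in> inner_nodes N" by (simp add: inner_nodes_def)
    then have "(discrete_laplacian N v (i, j))\<^sup>2 = real N ^ 4 * (dxx v i j + dyy v i j)\<^sup>2"
      by (simp add: discrete_laplacian_inner power_mult_distrib)
    also have "\<dots> \<ge> real N ^ 4 * (2 * (dxx v i j * dyy v i j))"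
      by (intro mult_left_mono) (simp_all add: power2_sum)
    finally show "2 * real N ^ 4 * (dxx v i j * dyy v i j) \<le> (discrete_laplacian N v (i, j))\<^sup>2"
      by (simp add: mult_ac)
  qed
  finally show ?thesis by (simp add: sum_inner_nodes)
qed

text \<open>
  Telescoping in both directions from the corner writes \<open>v (m, n)\<close> as the sum of \<open>m n\<close> mixed
  differences; the Cauchy-Schwarz inequality then costs a factor of at most \<open>N\<^sup>2\<close>.
\<close>

lemma discrete_sobolev:
  assumes v: "v \<in> grid_functions N" and k: "k \<in> inner_nodes N"
  shows "2 * (real N)\<^sup>2 * (v k)\<^sup>2 \<le> (\<Sum>k\<in>inner_nodes N. (discrete_laplacian N v k)\<^sup>2)"
proof -
  obtain m n where mn: "k = (m, n)" "m < N" "n < N" using k by (cases k) (auto simp: inner_nodes_iff)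
  note bd = grid_functions_boundary[OF v]
  have "(\<Sum>j<n. dxy v i j) = v (Suc i, n) - v (i, n)" for i
    using sum_lessThan_telescope[of "\<lambda>j. v (Suc i, j) - v (i, j)" n]
    by (simp add: dxy_def bd algebra_simps)
  then have "v k = (\<Sum>i<m. \<Sum>j<n. dxy v i j)"
    using sum_lessThan_telescope[of "\<lambda>i. v (i, n)" m] by (simp add: mn bd)
  also have "\<dots> = (\<Sum>q\<in>{..<m} \<times> {..<n}. dxy v (fst q) (snd q))"
    by (simp add: sum.cartesian_product case_prod_beta)
  finally have "(v k)\<^sup>2 = (\<Sum>q\<in>{..<m} \<times> {..<n}. dxy v (fst q) (snd q))\<^sup>2" by simp
  also have "\<dots> \<le> (\<Sum>q\<in>{..<m} \<times> {..<n}. (dxy v (fst q) (snd q))\<^sup>2) * real (m * n)"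
    using sum_squared_le_sum_of_squares[of "\<lambda>q. dxy v (fst q) (snd q)" "{..<m} \<times> {..<n}"] by simp
  also have "\<dots> \<le> (\<Sum>q\<in>{..<N} \<times> {..<N}. (dxy v (fst q) (snd q))\<^sup>2) * real (N * N)"
    using mn by (intro mult_mono sum_mono2 of_nat_mono mult_le_mono) (auto intro: sum_nonneg)
  also have "\<dots> = (real N)\<^sup>2 * (\<Sum>i<N. \<Sum>j<N. (dxy v i j)\<^sup>2)"
    by (simp add: sum.cartesian_product case_prod_beta power2_eq_square)
  finally have "2 * (real N)\<^sup>2 * (v k)\<^sup>2 \<le> 2 * (real N)\<^sup>2 * ((real N)\<^sup>2 * (\<Sum>i<N. \<Sum>j<N. (dxy v i j)\<^sup>2))"
    by (intro mult_left_mono) auto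
  also have "\<dots> = 2 * real N ^ 4 * (\<Sum>i<N. \<Sum>j<N. (dxy v i j)\<^sup>2)"
    by (simp flip: power_add mult.assoc)
  finally show ?thesis using sum_dxy_le_discrete_laplacian[OF v] by linarith
qed

section \<open>Stability and solvability of the reduced system\<close>

text \<open>
  Expanding the squares on the left-hand side produces the mixed terms \<open>2 \<alpha> \<langle>\<Delta> v, w\<rangle>\<close> and
  \<open>- 2 \<alpha> \<langle>v, \<Delta> w\<rangle>\<close>, where \<open>\<Delta>\<close> is the discrete Laplacian; by symmetry they cancel. The weight \<open>\<alpha>\<close>
  on the first residual is chosen for this.
\<close>

lemma stability_identity:
  assumes v: "v \<in> grid_functions N" and w: "w \<in> grid_functions N"
  shows "(\<Sum>k\<in>inner_nodes N. \<alpha> * (- discrete_laplacian N v k - w k)\<^sup>2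
      + (- \<alpha> * discrete_laplacian N w k + v k)\<^sup>2)
    = (\<Sum>k\<in>inner_nodes N. \<alpha> * (discrete_laplacian N v k)\<^sup>2 + \<alpha> * (w k)\<^sup>2
      + \<alpha>\<^sup>2 * (discrete_laplacian N w k)\<^sup>2 + (v k)\<^sup>2)"
proof -
  have "(\<Sum>k\<in>inner_nodes N. \<alpha> * (- discrete_laplacian N v k - w k)\<^sup>2
      + (- \<alpha> * discrete_laplacian N w k + v k)\<^sup>2)
    = (\<Sum>k\<in>inner_nodes N. (\<alpha> * (discrete_laplacian N v k)\<^sup>2 + \<alpha> * (w k)\<^sup>2
      + \<alpha>\<^sup>2 * (discrete_laplacian N w k)\<^sup>2 + (v k)\<^sup>2)
      + 2 * \<alpha> * (discrete_laplacian N v k * w k) - 2 * \<alpha> * (v k * discrete_laplacian N w k))"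
    by (intro sum.cong refl) (simp add: power2_eq_square algebra_simps)
  then show ?thesis
    by (simp add: sum.distrib sum_subtractf discrete_laplacian_symmetric[OF v w] flip: sum_distrib_left)
qed

text \<open>
  The weighted sum of the squared residuals is at most \<open>N\<^sup>2 (\<alpha> + 1) R\<^sup>2\<close>. The factor \<open>N\<^sup>2\<close> is cancelled by the
  one in the discrete Sobolev inequality, so the bound is uniform in \<open>N\<close>.
\<close>

lemma pointwise_stability:
  assumes "\<alpha> > 0" and v: "v \<in> grid_functions N" and w: "w \<in> grid_functions N"
    and r: "\<And>k. k \<in> inner_nodes N \<Longrightarrow> \<bar>- discrete_laplacian N v k - w k\<bar> \<le> R"
    and s: "\<And>k. k \<in> inner_nodes N \<Longrightarrow> \<bar>- \<alpha> * discrete_laplacian N w k + v k\<bar> \<le> R"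
    and k: "k \<in> inner_nodes N"
  shows "2 * \<alpha> * (v k)\<^sup>2 + 2 * \<alpha>\<^sup>2 * (w k)\<^sup>2 \<le> (\<alpha> + 1) * R\<^sup>2"
proof -
  define I where "I = inner_nodes N"
  have N: "real N > 0" using k by (cases k) (auto simp: inner_nodes_iff)
  have "(real N)\<^sup>2 * (2 * \<alpha> * (v k)\<^sup>2 + 2 * \<alpha>\<^sup>2 * (w k)\<^sup>2)
    = \<alpha> * (2 * (real N)\<^sup>2 * (v k)\<^sup>2) + \<alpha>\<^sup>2 * (2 * (real N)\<^sup>2 * (w k)\<^sup>2)"
    by (simp add: algebra_simps)
  also have "\<dots> \<le> \<alpha> * (\<Sum>k\<in>I. (discrete_laplacian N v k)\<^sup>2) + \<alpha>\<^sup>2 * (\<Sum>k\<in>I. (discrete_laplacian N w k)\<^sup>2)"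
    unfolding I_def using \<open>\<alpha> > 0\<close>
    by (intro add_mono mult_left_mono discrete_sobolev v w k) auto
  also have "\<dots> = (\<Sum>k\<in>I. \<alpha> * (discrete_laplacian N v k)\<^sup>2 + \<alpha>\<^sup>2 * (discrete_laplacian N w k)\<^sup>2)"
    by (simp add: sum.distrib sum_distrib_left)
  also have "\<dots> \<le> (\<Sum>k\<in>I. \<alpha> * (discrete_laplacian N v k)\<^sup>2 + \<alpha> * (w k)\<^sup>2
      + \<alpha>\<^sup>2 * (discrete_laplacian N w k)\<^sup>2 + (v k)\<^sup>2)"
    using \<open>\<alpha> > 0\<close> by (intro sum_mono) simp
  also have "\<dots> = (\<Sum>k\<in>I. \<alpha> * (- discrete_laplacian N v k - w k)\<^sup>2
      + (- \<alpha> * discrete_laplacian N w k + v k)\<^sup>2)"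
    unfolding I_def by (rule stability_identity[OF v w, symmetric])
  also have "\<dots> \<le> (\<Sum>k\<in>I. \<alpha> * R\<^sup>2 + R\<^sup>2)"
    unfolding I_def using \<open>\<alpha> > 0\<close> r s
    by (intro sum_mono add_mono mult_left_mono abs_le_square_iff[THEN iffD1]) force+
  also have "\<dots> = real (card I) * ((\<alpha> + 1) * R\<^sup>2)" by (simp add: algebra_simps)
  also have "\<dots> \<le> (real N)\<^sup>2 * ((\<alpha> + 1) * R\<^sup>2)"
  proof (intro mult_right_mono)
    have "card I \<le> N * N" unfolding I_def inner_nodes_def card_cartesian_product
      by (intro mult_le_mono) auto
    then show "real (card I) \<le> (real N)\<^sup>2" by (metis of_nat_mono of_nat_mult power2_eq_square)
  qed (use \<open>\<alpha> > 0\<close> in auto)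
  finally show ?thesis using N by simp
qed

text \<open>
  Testing the equation with \<open>q\<close> itself suffices, since the discrete Laplacian is negative semidefinite.
\<close>

lemma identity_minus_discrete_laplacian_injective:
  assumes q: "q \<in> grid_functions N" and 0: "\<And>k. k \<in> inner_nodes N \<Longrightarrow> q k - discrete_laplacian N q k = 0"
  shows "q k = 0"
proof (cases "k \<in> inner_nodes N")
  case True
  have "(\<Sum>k\<in>inner_nodes N. (q k)\<^sup>2) = (\<Sum>k\<in>inner_nodes N. discrete_laplacian N q k * q k)"
    by (intro sum.cong refl) (use 0 in \<open>simp add: power2_eq_square\<close>)
  also have "\<dots> \<le> 0" by (rule discrete_laplacian_nonpos[OF q])
  finally have "(\<Sum>k\<in>inner_nodes N. (q k)\<^sup>2) = 0"
    by (intro antisym sum_nonneg) auto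
  with True show ?thesis by (simp add: sum_nonneg_eq_0_iff)
qed (use q in \<open>simp add: grid_functions_zero\<close>)

lemma restrict_grid_in_grid_functions: "restrict_grid N w \<in> grid_functions N"
  by (auto simp: grid_functions_def restrict_grid_def)

text \<open>
  The function \<open>q\<close> in the proof is the residual of the second reduced equation. Inserting the third
  equation of the scheme into the second one leaves exactly \<open>q - \<Delta> q = 0\<close>, where \<open>\<Delta>\<close> is the
  discrete Laplacian, and the injectivity of this operator gives \<open>q = 0\<close>.
\<close>

lemma regularized_scheme_iff:
  assumes "\<alpha> > 0"
  shows "regularized_scheme \<alpha> 1 f g N z u p \<longleftrightarrow>
    z \<in> grid_functions N \<and> u \<in> grid_functions N \<and>
    (\<forall>k\<in>inner_nodes N. - discrete_laplacian N z k - u k = restrict_grid N f k \<and>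
       - \<alpha> * discrete_laplacian N u k + z k = restrict_grid N g k) \<and>
    p = (\<lambda>k. \<alpha> * (u k - discrete_laplacian N u k))"
    (is "?L \<longleftrightarrow> ?R")
proof -
  let ?D = "discrete_laplacian N" and ?g = "restrict_grid N g"
  define q where "q = (\<lambda>k. z k - ?g k - \<alpha> * ?D u k)"
  have q: "q \<in> grid_functions N" if "z \<in> grid_functions N"
    using that restrict_grid_in_grid_functions[of N g] discrete_laplacian_in_grid_functions[of N u]
    by (simp add: grid_functions_def q_def)
  have Dq: "?D q k = ?D z k - ?D ?g k - \<alpha> * ?D (?D u) k" for k
    using discrete_laplacian_linear[of N 1 "\<lambda>k. 1 * z k + (-1) * ?g k" "-\<alpha>" "?D u" k]
      discrete_laplacian_linear[of N 1 z "-1" ?g k] by (simp add: q_def)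
  have Dp: "?D (\<lambda>k. \<alpha> * (u k - ?D u k)) k = \<alpha> * ?D u k - \<alpha> * ?D (?D u) k" for k
    using discrete_laplacian_linear[of N \<alpha> u "-\<alpha>" "?D u" k] by (simp add: algebra_simps)
  show ?thesis
  proof
    assume L: ?L
    then have zu: "z \<in> grid_functions N" "u \<in> grid_functions N" "p \<in> grid_functions N"
      by (auto simp: regularized_scheme_def)
    have eqs: "- ?D z k - u k = restrict_grid N f k" "- ?D p k + (z k - ?D z k) = ?g k - ?D ?g k"
      "\<alpha> * (u k - ?D u k) - p k = 0" if "k \<in> inner_nodes N" for k
      using L that by (auto simp: regularized_scheme_def Let_def)
    have p: "p = (\<lambda>k. \<alpha> * (u k - ?D u k))"
    proof
      show "p k = \<alpha> * (u k - ?D u k)" for k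
        using eqs(3)[of k] zu by (cases "k \<in> inner_nodes N")
          (simp_all add: grid_functions_zero discrete_laplacian_outside)
    qed
    have "q k - ?D q k = 0" if "k \<in> inner_nodes N" for k
      using eqs(2)[OF that] unfolding p Dp Dq by (simp add: q_def algebra_simps)
    then have "q k = 0" for k
      by (rule identity_minus_discrete_laplacian_injective[OF q[OF zu(1)]])
    then show ?R using zu eqs(1) p by (simp add: q_def algebra_simps)
  next
    assume R: ?R
    then have zu: "z \<in> grid_functions N" "u \<in> grid_functions N"
      and p: "p = (\<lambda>k. \<alpha> * (u k - ?D u k))" by auto
    have "q k = 0" for k
      using R q[OF zu(1)] by (cases "k \<in> inner_nodes N")
        (simp_all add: grid_functions_zero, simp add: q_def algebra_simps)
    then have "q = (\<lambda>_. 0)" by auto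
    then have Dq0: "?D q k = 0" for k
      by (cases k) (simp add: discrete_laplacian_def)
    have "p \<in> grid_functions N"
      using zu p by (simp add: grid_functions_def discrete_laplacian_outside)
    moreover have "- ?D p k + (z k - ?D z k) = ?g k - ?D ?g k" for k
      using Dq[of k] Dq0[of k] \<open>q k = 0\<close> unfolding p Dp by (simp add: q_def algebra_simps)
    ultimately show ?L
      using R by (auto simp: regularized_scheme_def Let_def)
  qed
qed

text \<open>
  Eliminating \<open>u\<close> by the first equation leaves \<open>\<alpha> \<Delta> (\<Delta> z) + z = G - \<alpha> \<Delta> F\<close>, where \<open>\<Delta>\<close> is the discrete
  Laplacian. A solution of the homogeneous equation is, together with \<open>- \<Delta> z\<close>, a pair of grid
  functions without residuals, and so vanishes by stability.
\<close>

lemma reduced_system_solvable: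
  assumes "\<alpha> > 0" and F: "F \<in> grid_functions N" and G: "G \<in> grid_functions N"
  shows "\<exists>z u. z \<in> grid_functions N \<and> u \<in> grid_functions N \<and>
    (\<forall>k. - discrete_laplacian N z k - u k = F k \<and> - \<alpha> * discrete_laplacian N u k + z k = G k)"
proof -
  let ?D = "discrete_laplacian N"
  define L where "L = (\<lambda>z k. \<alpha> * ?D (?D z) k + z k)"
  have D_add: "?D (\<lambda>k. v k + w k) = (\<lambda>k. ?D v k + ?D w k)" for v w
    using discrete_laplacian_linear[of N 1 v 1 w] by auto
  have D_scale: "?D (\<lambda>k. c * v k) = (\<lambda>k. c * ?D v k)" for c v
    using discrete_laplacian_linear[of N c v 0 v] by auto
  have gf: "v \<in> grid_functions N \<longleftrightarrow> (\<forall>k. k \<notin> inner_nodes N \<longrightarrow> v k = 0)" for v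
    by (simp add: grid_functions_def)
  have b: "(\<lambda>k. G k - \<alpha> * ?D F k) \<in> grid_functions N"
    using G by (simp add: grid_functions_def discrete_laplacian_outside)
  have "\<exists>z. (\<forall>k. k \<notin> inner_nodes N \<longrightarrow> z k = 0) \<and> L z = (\<lambda>k. G k - \<alpha> * ?D F k)"
  proof (rule injective_imp_surjective_finite_support)
    show "L (\<lambda>k. v k + w k) = (\<lambda>k. L v k + L w k)" for v w
      by (simp add: L_def D_add algebra_simps)
    show "L (\<lambda>k. c * v k) = (\<lambda>k. c * L v k)" for c v
      by (simp add: L_def D_scale algebra_simps)
    show "\<forall>k. v k = 0" if v: "\<forall>k. k \<notin> inner_nodes N \<longrightarrow> v k = 0" and "\<forall>k. L v k = 0" for v
    proof
      have Dv: "?D (\<lambda>k. - ?D v k) k = - ?D (?D v) k" for k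
        using D_scale[of "-1" "?D v"] by simp
      fix k
      show "v k = 0"
      proof (cases "k \<in> inner_nodes N")
        case True
        have "2 * \<alpha> * (v k)\<^sup>2 + 2 * \<alpha>\<^sup>2 * (- ?D v k)\<^sup>2 \<le> (\<alpha> + 1) * 0\<^sup>2"
          using v \<open>\<forall>k. L v k = 0\<close> True \<open>\<alpha> > 0\<close>
          by (intro pointwise_stability) (auto simp: grid_functions_def L_def Dv discrete_laplacian_outside)
        then have "2 * \<alpha> * (v k)\<^sup>2 + 2 * (\<alpha> * ?D v k)\<^sup>2 \<le> 0"
          by (simp add: power_mult_distrib)
        moreover have "(\<alpha> * ?D v k)\<^sup>2 \<ge> 0" by simp
        ultimately have "2 * \<alpha> * (v k)\<^sup>2 \<le> 0" by linarith
        then show ?thesis using \<open>\<alpha> > 0\<close> by (simp add: mult_le_0_iff)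
      qed (use v in blast)
    qed
  qed (use b in \<open>auto simp: L_def grid_functions_def discrete_laplacian_outside\<close>)
  then obtain z where z: "z \<in> grid_functions N" "\<And>k. L z k = G k - \<alpha> * ?D F k"
    unfolding gf by metis
  define u where "u = (\<lambda>k. (-1) * ?D z k + (-1) * F k)"
  have Du: "?D u k = - ?D (?D z) k - ?D F k" for k
    unfolding u_def discrete_laplacian_linear by simp
  have "- \<alpha> * ?D u k + z k = G k" for k
  proof -
    have "\<alpha> * ?D (?D z) k + z k = G k - \<alpha> * ?D F k"
      using z(2)[of k] by (simp only: L_def)
    moreover have "- \<alpha> * ?D u k = \<alpha> * ?D (?D z) k + \<alpha> * ?D F k"
      by (simp only: Du) (simp only: algebra_simps)
    ultimately show ?thesis by linarith
  qed
  moreover have "u \<in> grid_functions N"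
    using F by (simp add: u_def grid_functions_def discrete_laplacian_outside)
  moreover have "- ?D z k - u k = F k" for k by (simp add: u_def)
  ultimately show ?thesis using z(1) by blast
qed

lemma reduced_system_unique:
  assumes "\<alpha> > 0" and v: "v \<in> grid_functions N" and w: "w \<in> grid_functions N"
    and "\<And>k. k \<in> inner_nodes N \<Longrightarrow> - discrete_laplacian N v k - w k = 0"
    and "\<And>k. k \<in> inner_nodes N \<Longrightarrow> - \<alpha> * discrete_laplacian N w k + v k = 0"
  shows "v k = 0" "w k = 0"
proof -
  have "v k = 0 \<and> w k = 0"
  proof (cases "k \<in> inner_nodes N")
    case True
    have "2 * \<alpha> * (v k)\<^sup>2 + 2 * \<alpha>\<^sup>2 * (w k)\<^sup>2 \<le> (\<alpha> + 1) * 0\<^sup>2"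
      using assms True by (intro pointwise_stability) simp_all
    then have "\<alpha> * (v k)\<^sup>2 + (\<alpha> * w k)\<^sup>2 \<le> 0" by (simp add: power_mult_distrib)
    moreover have "\<alpha> * (v k)\<^sup>2 \<ge> 0" "(\<alpha> * w k)\<^sup>2 \<ge> 0" using \<open>\<alpha> > 0\<close> by simp_all
    ultimately have "\<alpha> * (v k)\<^sup>2 = 0" "(\<alpha> * w k)\<^sup>2 = 0" by linarith+
    then show ?thesis using \<open>\<alpha> > 0\<close> by simp
  qed (use v w in \<open>simp add: grid_functions_zero\<close>)
  then show "v k = 0" "w k = 0" by simp_all
qed

lemma regularized_scheme_unique_solution:
  assumes "\<alpha> > 0"
  shows "\<exists>!(z, u, p). regularized_scheme \<alpha> 1 f g N z u p"
proof -
  let ?D = "discrete_laplacian N"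
  obtain z u where zu: "z \<in> grid_functions N" "u \<in> grid_functions N"
    "\<And>k. - ?D z k - u k = restrict_grid N f k" "\<And>k. - \<alpha> * ?D u k + z k = restrict_grid N g k"
    using reduced_system_solvable[OF assms restrict_grid_in_grid_functions restrict_grid_in_grid_functions]
    by metis
  let ?p = "\<lambda>u k. \<alpha> * (u k - ?D u k)"
  show ?thesis
  proof (rule ex1I[of _ "(z, u, ?p u)"])
    show "case (z, u, ?p u) of (z, u, p) \<Rightarrow> regularized_scheme \<alpha> 1 f g N z u p"
      using zu by (simp add: regularized_scheme_iff[OF assms])
  next
    fix t assume "case t of (z, u, p) \<Rightarrow> regularized_scheme \<alpha> 1 f g N z u p"
    then obtain z' u' p' where t: "t = (z', u', p')" and "regularized_scheme \<alpha> 1 f g N z' u' p'"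
      by (cases t) auto
    then have *: "z' \<in> grid_functions N" "u' \<in> grid_functions N" "p' = ?p u'"
      "\<And>k. k \<in> inner_nodes N \<Longrightarrow> - ?D z' k - u' k = restrict_grid N f k"
      "\<And>k. k \<in> inner_nodes N \<Longrightarrow> - \<alpha> * ?D u' k + z' k = restrict_grid N g k"
      by (simp_all add: regularized_scheme_iff[OF assms])
    define v where "v = (\<lambda>k. 1 * z' k + (-1) * z k)"
    define w where "w = (\<lambda>k. 1 * u' k + (-1) * u k)"
    have Dv: "?D v k = ?D z' k - ?D z k" and Dw: "?D w k = ?D u' k - ?D u k" for k
      unfolding v_def w_def discrete_laplacian_linear by simp_all
    have "- ?D v k - w k = 0" "- \<alpha> * ?D w k + v k = 0" if "k \<in> inner_nodes N" for k
      using *(4,5)[OF that] zu(3,4)[of k] unfolding Dv Dw by (simp_all add: v_def w_def algebra_simps)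
    moreover have "v \<in> grid_functions N" "w \<in> grid_functions N"
      using *(1,2) zu(1,2) by (simp_all add: v_def w_def grid_functions_def)
    ultimately have "v k = 0" "w k = 0" for k
      using reduced_system_unique[OF assms, of v N w] by blast+
    then have "z' = z" "u' = u" by (auto simp: v_def w_def)
    then show "t = (z, u, ?p u)" using t *(3) by simp
  qed
qed

section \<open>Truncation error\<close>

text \<open>
  The odd Taylor terms cancel. The fourth derivative is only controlled on the open interval, so
  Taylor's formula is applied on \<open>[-t, t]\<close> for \<open>t < h\<close> and the estimate is carried over to \<open>t = h\<close> by
  continuity of \<open>D 0\<close>. This matters when \<open>h\<close> or \<open>-h\<close> corresponds to a boundary point.
\<close>

lemma second_difference_error:
  fixes D :: "nat \<Rightarrow> real \<Rightarrow> real"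
  assumes "h > 0"
    and deriv: "\<And>k t. k < 4 \<Longrightarrow> \<bar>t\<bar> < h \<Longrightarrow> (D k has_real_derivative D (Suc k) t) (at t)"
    and bound: "\<And>t. \<bar>t\<bar> < h \<Longrightarrow> \<bar>D 4 t\<bar> \<le> M"
    and cont: "continuous_on {-h..h} (D 0)"
  shows "\<bar>D 0 h + D 0 (- h) - 2 * D 0 0 - h\<^sup>2 * D 2 0\<bar> \<le> M * h ^ 4 / 12"
proof -
  have less: "\<bar>D 0 t + D 0 (- t) - 2 * D 0 0 - t\<^sup>2 * D 2 0\<bar> \<le> M * t ^ 4 / 12" if t: "0 < t" "t < h" for t
  proof -
    have ex: "\<exists>\<xi>. \<bar>\<xi>\<bar> < h \<and> D 0 x = (\<Sum>m<4. D m 0 / fact m * x ^ m) + D 4 \<xi> / fact 4 * x ^ 4"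
      if "x = t \<or> x = - t" for x
      using Taylor[of 4 D "D 0" "-t" t 0 x] deriv t that
      by (force simp: less_Suc_eq_le split: if_splits)
    obtain \<xi> where \<xi>: "\<bar>\<xi>\<bar> < h" "D 0 t = (\<Sum>m<4. D m 0 / fact m * t ^ m) + D 4 \<xi> / fact 4 * t ^ 4"
      using ex[of t] by auto
    obtain \<eta> where \<eta>: "\<bar>\<eta>\<bar> < h"
      "D 0 (-t) = (\<Sum>m<4. D m 0 / fact m * (-t) ^ m) + D 4 \<eta> / fact 4 * (-t) ^ 4"
      using ex[of "-t"] by auto
    have "D 0 t + D 0 (- t) - 2 * D 0 0 - t\<^sup>2 * D 2 0 = (D 4 \<xi> + D 4 \<eta>) * t ^ 4 / 24"
      unfolding \<xi>(2) \<eta>(2)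
      by (simp add: eval_nat_numeral sum.lessThan_Suc fact_numeral field_simps)
    then have "\<bar>D 0 t + D 0 (- t) - 2 * D 0 0 - t\<^sup>2 * D 2 0\<bar> = \<bar>D 4 \<xi> + D 4 \<eta>\<bar> * t ^ 4 / 24"
      by (simp only: abs_mult abs_divide) simp
    also have "\<dots> \<le> (M + M) * t ^ 4 / 24"
      using bound[OF \<xi>(1)] bound[OF \<eta>(1)] by (intro divide_right_mono mult_right_mono) auto
    finally show ?thesis by simp
  qed
  let ?g = "\<lambda>t. M * t ^ 4 / 12 - \<bar>D 0 t + D 0 (- t) - 2 * D 0 0 - t\<^sup>2 * D 2 0\<bar>"
  have "continuous_on {0..h} ?g"
    by (intro continuous_intros continuous_on_subset[OF cont]
        continuous_on_compose2[OF cont, of _ uminus]) auto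
  then have "closed ({0..h} \<inter> ?g -` {0..})"
    by (intro continuous_closed_preimage) auto
  moreover have "{0<..<h} \<subseteq> {0..h} \<inter> ?g -` {0..}" using less by auto
  ultimately have "closure {0<..<h} \<subseteq> {0..h} \<inter> ?g -` {0..}" by (rule closure_minimal[rotated])
  moreover have "h \<in> closure {0<..<h}" using \<open>h > 0\<close> by simp
  ultimately have "h \<in> ?g -` {0..}" by blast
  then show ?thesis by simp
qed

lemma has_derivative_partial_along_line:
  assumes "(\<lambda>s. v (x + t *\<^sub>R b + s *\<^sub>R b)) differentiable at 0"
  shows "((\<lambda>s. v (x + s *\<^sub>R b)) has_real_derivative partial b v (x + t *\<^sub>R b)) (at t)"
proof -
  have "((\<lambda>s. v (x + t *\<^sub>R b + s *\<^sub>R b)) has_real_derivative partial b v (x + t *\<^sub>R b)) (at 0)"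
    using assms by (simp add: partial_def DERIV_deriv_iff_real_differentiable)
  then have "((\<lambda>s. v (x + (s + t) *\<^sub>R b)) has_real_derivative partial b v (x + t *\<^sub>R b)) (at 0)"
    by (simp add: algebra_simps)
  then show ?thesis using DERIV_shift[of "\<lambda>s. v (x + s *\<^sub>R b)" _ 0 t] by simp
qed

lemma derivs_extend_funpow:
  "derivs_extend (k + m) S v \<Longrightarrow> b \<in> Basis \<Longrightarrow> derivs_extend m S ((partial b ^^ k) v)"
  by (induct k arbitrary: v) (simp_all add: funpow_Suc_right del: funpow.simps(2))

lemma derivs_extend_bounded:
  assumes "derivs_extend m S v" "bounded S"
  obtains M where "\<And>x. x \<in> S \<Longrightarrow> \<bar>v x\<bar> \<le> M"
proof -
  obtain w where w: "continuous_on (closure S) w" "\<forall>x\<in>S. w x = v x"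
    using assms(1) by (cases m) auto
  have "bounded (w ` closure S)"
    using assms(2) w(1) by (intro compact_imp_bounded compact_continuous_image) auto
  then obtain M where "\<forall>y\<in>w ` closure S. norm y \<le> M" by (auto simp: bounded_iff)
  then show ?thesis using that[of M] w(2) closure_subset by fastforce
qed

text \<open>
  Only the open segment has to lie in \<open>S\<close>: its end points are then in the closure, where \<open>v\<close> is
  still continuous.
\<close>

lemma second_difference_truncation:
  fixes S :: "'a::euclidean_space set"
  assumes v: "v \<in> C_closure 4 S" and b: "b \<in> Basis" and "h > 0"
    and inside: "\<And>t. \<bar>t\<bar> < h \<Longrightarrow> x + t *\<^sub>R b \<in> S"
    and bound: "\<And>y. y \<in> S \<Longrightarrow> \<bar>(partial b ^^ 4) v y\<bar> \<le> M"
  shows "\<bar>v (x + h *\<^sub>R b) + v (x - h *\<^sub>R b) - 2 * v x - h\<^sup>2 * partial b (partial b v) x\<bar> \<le> M * h ^ 4 / 12"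
proof -
  define D where "D = (\<lambda>k t. (partial b ^^ k) v (x + t *\<^sub>R b))"
  have "\<bar>D 0 h + D 0 (- h) - 2 * D 0 0 - h\<^sup>2 * D 2 0\<bar> \<le> M * h ^ 4 / 12"
  proof (rule second_difference_error[OF \<open>h > 0\<close>])
    fix k :: nat and t :: real assume k: "k < 4" and t: "\<bar>t\<bar> < h"
    then have "4 = k + Suc (3 - k)" by simp
    then have "derivs_extend (k + Suc (3 - k)) S v" using v by (simp add: C_closure_def)
    from derivs_extend_funpow[OF this b]
    have "(\<lambda>s. (partial b ^^ k) v (x + t *\<^sub>R b + s *\<^sub>R b)) differentiable at 0"
      using b inside[OF t] by auto
    from has_derivative_partial_along_line[OF this]
    show "(D k has_real_derivative D (Suc k) t) (at t)" by (simp add: D_def)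
  next
    show "\<bar>D 4 t\<bar> \<le> M" if "\<bar>t\<bar> < h" for t
      using bound inside[OF that] by (simp add: D_def)
  next
    have "x + t *\<^sub>R b \<in> closure S" if "t \<in> {-h..h}" for t
    proof -
      have "(\<lambda>t. x + t *\<^sub>R b) ` closure {-h<..<h} \<subseteq> closure ((\<lambda>t. x + t *\<^sub>R b) ` {-h<..<h})"
        by (intro image_closure_subset continuous_intros closed_closure closure_subset)
      also have "\<dots> \<subseteq> closure S" using inside by (intro closure_mono) auto
      finally show ?thesis using that \<open>h > 0\<close> by (simp add: image_subset_iff)
    qed
    then show "continuous_on {-h..h} (D 0)"
      using v unfolding D_def C_closure_def
      by (auto intro!: continuous_on_compose2[of "closure S" v] continuous_intros)
  qed
  then show ?thesis by (simp add: D_def numeral_2_eq_2)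
qed

lemma closure_\<Omega>: "closure \<Omega> = {0..1} \<times> {0..1}"
  by (simp add: \<Omega>_def closure_Times)

lemma frontier_\<Omega>: "frontier \<Omega> = {0..1} \<times> {0..1} - \<Omega>"
  unfolding frontier_def closure_\<Omega> by (simp add: \<Omega>_def interior_Times interior_open)

lemma laplacian_prod: "laplacian v x = partial (1, 0) (partial (1, 0) v) x + partial (0, 1) (partial (0, 1) v) x"
  for v :: "real \<times> real \<Rightarrow> real"
proof -
  have B: "(Basis :: (real \<times> real) set) = {(1, 0), (0, 1)}" by (auto simp: Basis_prod_def)
  show ?thesis unfolding laplacian_def B by simp
qed

text \<open>
  For functions that vanish on the boundary of the square, extension by zero is sampling up to and
  including the boundary nodes.
\<close>

lemma restrict_grid_eq:
  assumes "\<forall>x\<in>frontier \<Omega>. w x = 0" "i \<le> N" "j \<le> N" "N > 0"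
  shows "restrict_grid N w (i, j) = w (real i / real N, real j / real N)"
proof (cases "(i, j) \<in> inner_nodes N")
  case False
  then have "(real i / real N, real j / real N) \<in> frontier \<Omega>"
    using assms(2-) unfolding frontier_\<Omega> unfolding \<Omega>_def inner_nodes_def by (auto simp: field_simps)
  then show ?thesis using False assms by (simp add: restrict_grid_def)
qed (simp add: restrict_grid_def)

lemma discrete_laplacian_truncation:
  assumes v: "v \<in> C_closure 4 \<Omega>" and bd: "\<forall>x\<in>frontier \<Omega>. v x = 0"
  obtains M where "M \<ge> 0" "\<And>N i j. (i, j) \<in> inner_nodes N \<Longrightarrow>
    \<bar>discrete_laplacian N (restrict_grid N v) (i, j) - laplacian v (real i / real N, real j / real N)\<bar>
      \<le> M * (1 / real N)\<^sup>2"
proof -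
  have "\<exists>M. \<forall>y\<in>\<Omega>. \<bar>(partial b ^^ 4) v y\<bar> \<le> M" if "b \<in> Basis" for b
  proof -
    have "bounded \<Omega>" by (simp add: \<Omega>_def bounded_Times)
    moreover have "derivs_extend 0 \<Omega> ((partial b ^^ 4) v)"
      using v derivs_extend_funpow[of 4 0 \<Omega> v b] that by (simp add: C_closure_def)
    ultimately show ?thesis using derivs_extend_bounded by metis
  qed
  moreover have B: "(1, 0) \<in> (Basis :: (real \<times> real) set)" "(0, 1) \<in> (Basis :: (real \<times> real) set)"
    by (auto simp: Basis_prod_def)
  ultimately obtain M1 M2 where
    M1: "\<And>y. y \<in> \<Omega> \<Longrightarrow> \<bar>(partial (1, 0) ^^ 4) v y\<bar> \<le> M1" and
    M2: "\<And>y. y \<in> \<Omega> \<Longrightarrow> \<bar>(partial (0, 1) ^^ 4) v y\<bar> \<le> M2"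
    by metis
  have "(1/2, 1/2) \<in> \<Omega>" by (simp add: \<Omega>_def)
  from M1[OF this] M2[OF this] have nn: "M1 \<ge> 0" "M2 \<ge> 0" by linarith+
  show ?thesis
  proof (rule that[of "(M1 + M2) / 12"])
    fix N i j assume ij: "(i, j) \<in> inner_nodes N"
    define h where "h = 1 / real N"
    define x where "x = (real i / real N, real j / real N)"
    have ij': "1 \<le> i" "i < N" "1 \<le> j" "j < N" "N > 0" using ij by (auto simp: inner_nodes_def)
    then have h: "h > 0" by (simp add: h_def)
    have lo: "h \<le> real i / real N" "h \<le> real j / real N"
      using ij' by (auto simp: h_def divide_right_mono)
    have hi: "real i / real N \<le> 1 - h" "real j / real N \<le> 1 - h"
      using ij' by (auto simp: h_def field_simps)
    have e1: "\<bar>v (x + h *\<^sub>R (1, 0)) + v (x - h *\<^sub>R (1, 0)) - 2 * v x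
        - h\<^sup>2 * partial (1, 0) (partial (1, 0) v) x\<bar> \<le> M1 * h ^ 4 / 12"
      by (rule second_difference_truncation[OF v B(1) h _ M1]) (use lo hi h in \<open>auto simp: x_def \<Omega>_def\<close>)
    have e2: "\<bar>v (x + h *\<^sub>R (0, 1)) + v (x - h *\<^sub>R (0, 1)) - 2 * v x
        - h\<^sup>2 * partial (0, 1) (partial (0, 1) v) x\<bar> \<le> M2 * h ^ 4 / 12"
      by (rule second_difference_truncation[OF v B(2) h _ M2]) (use lo hi h in \<open>auto simp: x_def \<Omega>_def\<close>)
    note node_simps = x_def h_def of_nat_diff add_divide_distrib diff_divide_distrib add.commute
    have nodes:
      "restrict_grid N v (i + 1, j) = v (x + h *\<^sub>R (1, 0))"
      "restrict_grid N v (i - 1, j) = v (x - h *\<^sub>R (1, 0))"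
      "restrict_grid N v (i, j + 1) = v (x + h *\<^sub>R (0, 1))"
      "restrict_grid N v (i, j - 1) = v (x - h *\<^sub>R (0, 1))"
      "restrict_grid N v (i, j) = v x"
      using ij' by (simp_all add: restrict_grid_eq[OF bd] node_simps)
    define a where "a = v (x + h *\<^sub>R (1, 0)) + v (x - h *\<^sub>R (1, 0)) - 2 * v x"
    define c where "c = v (x + h *\<^sub>R (0, 1)) + v (x - h *\<^sub>R (0, 1)) - 2 * v x"
    have "discrete_laplacian N (restrict_grid N v) (i, j) = (a + c) / h\<^sup>2"
      using ij unfolding discrete_laplacian_def prod.case nodes a_def c_def h_def[symmetric]
      by (simp add: algebra_simps)
    then have "discrete_laplacian N (restrict_grid N v) (i, j) - laplacian v x
      = ((a - h\<^sup>2 * partial (1, 0) (partial (1, 0) v) x)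
          + (c - h\<^sup>2 * partial (0, 1) (partial (0, 1) v) x)) / h\<^sup>2"
      using h by (simp add: laplacian_prod field_simps)
    then have "\<bar>discrete_laplacian N (restrict_grid N v) (i, j) - laplacian v x\<bar>
      = \<bar>(a - h\<^sup>2 * partial (1, 0) (partial (1, 0) v) x)
          + (c - h\<^sup>2 * partial (0, 1) (partial (0, 1) v) x)\<bar> / h\<^sup>2"
      by (simp only: abs_divide) simp
    also have "\<dots> \<le> (M1 * h ^ 4 / 12 + M2 * h ^ 4 / 12) / h\<^sup>2"
      using e1 e2 unfolding a_def[symmetric] c_def[symmetric]
      by (intro divide_right_mono) (linarith, simp)
    also have "\<dots> = (M1 + M2) / 12 * h\<^sup>2"
      using h by (simp add: field_simps eval_nat_numeral)
    finally show "\<bar>discrete_laplacian N (restrict_grid N v) (i, j)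
        - laplacian v (real i / real N, real j / real N)\<bar> \<le> (M1 + M2) / 12 * (1 / real N)\<^sup>2"
      by (simp add: x_def h_def)
  qed (use nn in auto)
qed

section \<open>Convergence\<close>

lemma grid_norm_le:
  assumes "N \<ge> 2" "\<And>k. k \<in> inner_nodes N \<Longrightarrow> \<bar>v k\<bar> \<le> B"
  shows "grid_norm N v \<le> B"
proof -
  have "inner_nodes N \<noteq> {}" using assms(1) by (auto simp: inner_nodes_def)
  then show ?thesis unfolding grid_norm_def using assms(2) by (subst Max_le_iff) auto
qed

theorem theorem4p1:
  fixes \<alpha> \<gamma> :: real and f g z u p :: "real \<times> real \<Rightarrow> real"
  assumes "\<alpha> > 0"
    and "continuous_on (closure \<Omega>) f" and "continuous_on (closure \<Omega>) g"
    and "optimality_system \<alpha> f g z u p"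
    and "{z, u, p} \<subseteq> C_closure 4 \<Omega>"
    and "\<gamma> = 1"
  shows "\<exists>C>0. \<forall>N\<ge>2.
    (\<exists>!(z\<^sub>h, u\<^sub>h, p\<^sub>h). regularized_scheme \<alpha> \<gamma> f g N z\<^sub>h u\<^sub>h p\<^sub>h) \<and>
    (\<forall>z\<^sub>h u\<^sub>h p\<^sub>h. regularized_scheme \<alpha> \<gamma> f g N z\<^sub>h u\<^sub>h p\<^sub>h \<longrightarrow>
       grid_norm N (\<lambda>k. restrict_grid N z k - z\<^sub>h k) \<le> C * (1 / real N)\<^sup>2 \<and>
       grid_norm N (\<lambda>k. restrict_grid N u k - u\<^sub>h k) \<le> C * (1 / real N)\<^sup>2)"
proof -
  let ?D = discrete_laplacian
  note \<alpha> = \<open>\<alpha> > 0\<close>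
  have state: "\<And>x. x \<in> \<Omega> \<Longrightarrow> - laplacian z x - u x = f x"
    and adjoint: "\<And>x. x \<in> \<Omega> \<Longrightarrow> - laplacian p x + z x = g x"
    and control: "\<And>x. x \<in> \<Omega> \<Longrightarrow> p x = \<alpha> * u x"
    and z0: "\<forall>x\<in>frontier \<Omega>. z x = 0" and p0: "\<forall>x\<in>frontier \<Omega>. p x = 0"
    using assms(4) unfolding optimality_system_def by simp_all
  have zC: "z \<in> C_closure 4 \<Omega>" and pC: "p \<in> C_closure 4 \<Omega>"
    using assms(5) by simp_all
  obtain Mz where Mz: "Mz \<ge> 0" "\<And>N i j. (i, j) \<in> inner_nodes N \<Longrightarrow>
    \<bar>?D N (restrict_grid N z) (i, j) - laplacian z (real i / real N, real j / real N)\<bar> \<le> Mz * (1 / real N)\<^sup>2"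
    using discrete_laplacian_truncation[OF zC z0] by metis
  obtain Mp where Mp: "Mp \<ge> 0" "\<And>N i j. (i, j) \<in> inner_nodes N \<Longrightarrow>
    \<bar>?D N (restrict_grid N p) (i, j) - laplacian p (real i / real N, real j / real N)\<bar> \<le> Mp * (1 / real N)\<^sup>2"
    using discrete_laplacian_truncation[OF pC p0] by metis
  \<comment> \<open>With residuals bounded by \<open>R\<close>, stability bounds both squared errors by \<open>K R\<^sup>2\<close>. The summand
    1 in \<open>C\<close> makes it positive even if the truncation bounds are 0.\<close>
  define K where "K = (\<alpha> + 1) / (2 * \<alpha>) + (\<alpha> + 1) / (2 * \<alpha>\<^sup>2)"
  define C where "C = sqrt K * (Mz + Mp) + 1"
  have K: "K \<ge> 0" using \<alpha> by (simp add: K_def)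
  have "C > 0" using K Mz(1) Mp(1) by (simp add: C_def add_nonneg_pos)
  moreover have "\<bar>restrict_grid N z k - z\<^sub>h k\<bar> \<le> C * (1 / real N)\<^sup>2 \<and>
      \<bar>restrict_grid N u k - u\<^sub>h k\<bar> \<le> C * (1 / real N)\<^sup>2"
    if scheme: "regularized_scheme \<alpha> \<gamma> f g N z\<^sub>h u\<^sub>h p\<^sub>h" and k: "k \<in> inner_nodes N"
    for N z\<^sub>h u\<^sub>h p\<^sub>h k
  proof -
    have disc: "z\<^sub>h \<in> grid_functions N" "u\<^sub>h \<in> grid_functions N"
      "\<And>k. k \<in> inner_nodes N \<Longrightarrow> - ?D N z\<^sub>h k - u\<^sub>h k = restrict_grid N f k"
      "\<And>k. k \<in> inner_nodes N \<Longrightarrow> - \<alpha> * ?D N u\<^sub>h k + z\<^sub>h k = restrict_grid N g k"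
      using scheme unfolding \<open>\<gamma> = 1\<close> regularized_scheme_iff[OF \<alpha>] by auto
    define v where "v = (\<lambda>k. 1 * restrict_grid N z k + (-1) * z\<^sub>h k)"
    define w where "w = (\<lambda>k. 1 * restrict_grid N u k + (-1) * u\<^sub>h k)"
    define R where "R = (Mz + Mp) * (1 / real N)\<^sup>2"
    have Dv: "?D N v k = ?D N (restrict_grid N z) k - ?D N z\<^sub>h k"
      and Dw: "?D N w k = ?D N (restrict_grid N u) k - ?D N u\<^sub>h k" for k
      unfolding v_def w_def discrete_laplacian_linear by simp_all
    have node: "(real i / real N, real j / real N) \<in> \<Omega>" if "(i, j) \<in> inner_nodes N" for i j
      using that by (auto simp: inner_nodes_iff \<Omega>_def)
    \<comment> \<open>On the nodes \<open>p = \<alpha> u\<close>, so the truncation error of \<open>p\<close> also serves for \<open>u\<close>. The term with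
      factor 0 is there to match the linearity lemma.\<close>
    have "restrict_grid N p = (\<lambda>k. \<alpha> * restrict_grid N u k + 0 * restrict_grid N u k)"
      using control node by (auto simp: restrict_grid_def)
    then have Dp: "\<alpha> * ?D N (restrict_grid N u) k = ?D N (restrict_grid N p) k" for k
      using discrete_laplacian_linear[of N \<alpha> "restrict_grid N u" 0 "restrict_grid N u" k] by simp
    have R: "Mz * (1 / real N)\<^sup>2 \<le> R" "Mp * (1 / real N)\<^sup>2 \<le> R"
      using Mz(1) Mp(1) unfolding R_def by (intro mult_right_mono; simp)+
    have res: "\<bar>- ?D N v k - w k\<bar> \<le> R \<and> \<bar>- \<alpha> * ?D N w k + v k\<bar> \<le> R"
      if k: "k \<in> inner_nodes N" for k
    proof -
      obtain i j where ij: "k = (i, j)" by (cases k)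
      define x where "x = (real i / real N, real j / real N)"
      have x: "x \<in> \<Omega>" using node k by (simp add: ij x_def)
      have at_node: "restrict_grid N y k = y x" for y
        using k by (simp add: ij x_def restrict_grid_def)
      have "- ?D N v k - w k = laplacian z x - ?D N (restrict_grid N z) k"
        using disc(3)[OF k] state[OF x] unfolding Dv by (simp add: w_def at_node)
      moreover have "- \<alpha> * ?D N w k + v k = laplacian p x - ?D N (restrict_grid N p) k"
        using disc(4)[OF k] adjoint[OF x] Dp[of k] unfolding Dw by (simp add: v_def at_node algebra_simps)
      ultimately show ?thesis
        using Mz(2)[of i j N] Mp(2)[of i j N] R k
        by (simp add: ij x_def abs_minus_commute)
    qed
    have "v \<in> grid_functions N" "w \<in> grid_functions N"
      using disc(1,2) restrict_grid_in_grid_functions[of N z] restrict_grid_in_grid_functions[of N u]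
      by (simp_all add: v_def w_def grid_functions_def)
    then have est: "2 * \<alpha> * (v k)\<^sup>2 + 2 * \<alpha>\<^sup>2 * (w k)\<^sup>2 \<le> (\<alpha> + 1) * R\<^sup>2"
      using res k by (intro pointwise_stability[OF \<alpha>]) auto
    have pos: "2 * \<alpha> * (v k)\<^sup>2 \<ge> 0" "2 * \<alpha>\<^sup>2 * (w k)\<^sup>2 \<ge> 0"
      using \<alpha> by simp_all
    have C: "(C * (1 / real N)\<^sup>2)\<^sup>2 \<ge> K * R\<^sup>2" and C0: "C * (1 / real N)\<^sup>2 \<ge> 0"
    proof -
      have "K * R\<^sup>2 = (sqrt K * R)\<^sup>2" using K by (simp add: power_mult_distrib)
      also have "\<dots> \<le> (C * (1 / real N)\<^sup>2)\<^sup>2"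
      proof (intro power_mono)
        have "C * (1 / real N)\<^sup>2 = sqrt K * R + (1 / real N)\<^sup>2"
          unfolding C_def R_def by (simp only: distrib_right mult.assoc mult_1_left)
        then show "sqrt K * R \<le> C * (1 / real N)\<^sup>2" by simp
        show "0 \<le> sqrt K * R" using K Mz(1) Mp(1) by (simp add: R_def)
      qed
      finally show "(C * (1 / real N)\<^sup>2)\<^sup>2 \<ge> K * R\<^sup>2" .
      show "C * (1 / real N)\<^sup>2 \<ge> 0" using \<open>C > 0\<close> by simp
    qed
    have "2 * \<alpha> * (v k)\<^sup>2 \<le> (\<alpha> + 1) * R\<^sup>2"
      using est pos by linarith
    then have "(v k)\<^sup>2 \<le> (\<alpha> + 1) / (2 * \<alpha>) * R\<^sup>2"
      using \<alpha> by (simp add: field_simps)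
    also have "\<dots> \<le> K * R\<^sup>2"
      unfolding K_def using \<alpha> by (intro mult_right_mono) auto
    finally have "(v k)\<^sup>2 \<le> (C * (1 / real N)\<^sup>2)\<^sup>2" using C by linarith
    then have v: "\<bar>v k\<bar> \<le> C * (1 / real N)\<^sup>2"
      using abs_le_square_iff[of "v k" "C * (1 / real N)\<^sup>2"] abs_of_nonneg[OF C0] by metis
    have "2 * \<alpha>\<^sup>2 * (w k)\<^sup>2 \<le> (\<alpha> + 1) * R\<^sup>2"
      using est pos by linarith
    then have "(w k)\<^sup>2 \<le> (\<alpha> + 1) / (2 * \<alpha>\<^sup>2) * R\<^sup>2"
      using \<alpha> by (simp add: field_simps)
    also have "\<dots> \<le> K * R\<^sup>2"
      unfolding K_def using \<alpha> by (intro mult_right_mono) auto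
    finally have "(w k)\<^sup>2 \<le> (C * (1 / real N)\<^sup>2)\<^sup>2" using C by linarith
    then have w: "\<bar>w k\<bar> \<le> C * (1 / real N)\<^sup>2"
      using abs_le_square_iff[of "w k" "C * (1 / real N)\<^sup>2"] abs_of_nonneg[OF C0] by metis
    show ?thesis using v w by (simp add: v_def w_def)
  qed
  moreover have "\<exists>!(z\<^sub>h, u\<^sub>h, p\<^sub>h). regularized_scheme \<alpha> \<gamma> f g N z\<^sub>h u\<^sub>h p\<^sub>h" for N
    unfolding \<open>\<gamma> = 1\<close> by (rule regularized_scheme_unique_solution[OF \<alpha>])
  ultimately show ?thesis
    by (intro exI[of _ C] conjI allI impI grid_norm_le) simp_all
qed

end
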